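(* An integer $n > 1$ is a Lucas-Carmichael integer if and only if $n$ is square-free and $S_{p+2}(n+2)\equiv 1 \pmod{p+1}$ for every prime divisor $p$ of $n$. That is, $$\mathcal{L}_C=\Big\{ n\in \mathcal{S} : p\mid n \Longrightarrow S_{p+2}(n+2)\equiv 1 \pmod{p+1}\Big\},$$ where $p$ denotes a prime, $\mathcal{L}_C$ denotes the set of all Lucas-Carmichael integers and $\mathcal{S}$ denotes the set of all positive square-free integers.
   Context: A Lucas-Carmichael integer is a square-free positive composite integer $m$ such that $p+1 \mid m+1$ for every prime $p$ dividing $m$. For an integer $b\ge 2$ and a positive integer $N$, $S_b(N)$ denotes the sum of the base-$b$ digits of $N$.
   Formalization: The equivalence is stated for composite n > 1 and the displayed set is restricted to composite n, since every prime n (where S_{n+2}(n+2) = 1) and, in the set, n = 1 satisfy the digit condition without being Lucas-Carmichael integers. *)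

theory Defs
  imports "HOL-Number_Theory.Number_Theory"
    "HOL-Computational_Algebra.Squarefree"
begin

definition composite :: "nat \<Rightarrow> bool" where
  "composite m \<longleftrightarrow> 1 < m \<and> \<not> prime m"

definition lucas_carmichael :: "nat \<Rightarrow> bool" where
  "lucas_carmichael m \<longleftrightarrow>
     squarefree m \<and> composite m \<and> (\<forall>p. prime p \<and> p dvd m \<longrightarrow> p + 1 dvd m + 1)"

definition Lucas_Carmichael :: "nat set" where
  "Lucas_Carmichael = {m. lucas_carmichael m}"

text \<open>Positivity is automatic here: \<^term>\<open>0::nat\<close> is not squarefree.\<close>

definition Squarefree :: "nat set" where
  "Squarefree = {m. squarefree m}"

text \<open>Sum of the base-\<^term>\<open>b\<close> digits of \<^term>\<open>N\<close>, meaningful for \<^prop>\<open>2 \<le> b\<close>; the value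
  \<^term>\<open>0::nat\<close> for \<^prop>\<open>b < 2\<close> only serves to make the recursion total.\<close>

function digit_sum :: "nat \<Rightarrow> nat \<Rightarrow> nat" where
  "digit_sum b N = (if b < 2 \<or> N = 0 then 0 else N mod b + digit_sum b (N div b))"
  by auto
termination
  by (relation "measure snd") auto

declare digit_sum.simps [simp del]

end

theory Submission
  imports Defs
begin

text \<open>Casting out nines in base \<open>b\<close>: since b is 1 modulo b - 1, a number is
  congruent to its digit sum modulo b - 1 (\<open>digit_sum_cong\<close>). For b = p + 2 the modulus
  is p + 1, so the digit sum of n + 2 is 1 modulo p + 1 exactly when p + 1 divides n + 1
  (\<open>digit_sum_cong_1_iff\<close>). The digit condition is thus the divisibility condition of
  the definition, prime by prime.\<close>

lemma digit_sum_cong: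
  assumes "2 \<le> b"
  shows "[digit_sum b N = N] (mod (b - 1))"
proof (induction N rule: less_induct)
  case (less N)
  show ?case
  proof (cases "N = 0")
    case True
    then show ?thesis by (simp add: digit_sum.simps [of b 0])
  next
    case False
    with assms have "N div b < N" by simp
    then have "[digit_sum b (N div b) = N div b] (mod (b - 1))"
      by (rule less)
    \<comment> \<open>Here b = (b - 1) + 1 enters; for b = 2 the modulus is 1 and the claim is
      trivial.\<close>
    moreover have "[1 * (N div b) = b * (N div b)] (mod (b - 1))"
      using assms by (intro cong_mult cong_refl) (simp add: cong_def le_mod_geq)
    ultimately have "[digit_sum b (N div b) = b * (N div b)] (mod (b - 1))"
      by (simp add: cong_trans)
    then have "[N mod b + digit_sum b (N div b) = N mod b + b * (N div b)] (mod (b - 1))"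
      by (intro cong_add cong_refl)
    then show ?thesis
      using assms False by (simp add: digit_sum.simps [of b N])
  qed
qed

lemma digit_sum_cong_1_iff:
  "[digit_sum (p + 2) (n + 2) = 1] (mod (p + 1)) \<longleftrightarrow> p + 1 dvd n + 1"
proof -
  have "[digit_sum (p + 2) (n + 2) = n + 2] (mod (p + 1))"
    using digit_sum_cong [of "p + 2" "n + 2"] by simp
  \<comment> \<open>Writing n + 2 as n + 1 + 1 and 1 as 0 + 1 lets a 1 be cancelled without
    subtraction on \<open>nat\<close>.\<close>
  then have "[digit_sum (p + 2) (n + 2) = 1] (mod (p + 1)) \<longleftrightarrow> [n + 1 + 1 = 0 + 1] (mod (p + 1))"
    by (simp add: cong_def)
  also have "\<dots> \<longleftrightarrow> p + 1 dvd n + 1"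
    by (simp only: cong_add_rcancel_nat cong_0_iff)
  finally show ?thesis .
qed

text \<open>Compositeness stands on both sides because the digit condition cannot detect it: it
  holds for every prime n (take p = n) and vacuously for n = 1.\<close>

theorem proposition3p1:
  "(\<forall>n::nat. n > 1 \<and> composite n \<longrightarrow>
      (lucas_carmichael n \<longleftrightarrow>
        squarefree n \<and>
        (\<forall>p. prime p \<and> p dvd n \<longrightarrow> [digit_sum (p + 2) (n + 2) = 1] (mod (p + 1))))) \<and>
   Lucas_Carmichael =
     {n \<in> Squarefree. composite n \<and>
        (\<forall>p. prime p \<and> p dvd n \<longrightarrow> [digit_sum (p + 2) (n + 2) = 1] (mod (p + 1)))}"
  unfolding digit_sum_cong_1_iff Lucas_Carmichael_def Squarefree_def lucas_carmichael_def
  by auto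

end
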